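(* For $k \in \mathbb{Z}$ and $n \geq 0$, \begin{equation*} C_{n+1}^{(k)}(x)=\sum_{l=0}^{n}S_{1}(n,l)\sum_{j=0}^{l}\frac{(-1)^{j}\binom{l}{j}}{(l-j+2)^{k}}(x+1)^{j}-xC_{n}^{(k)}(x+1). \end{equation*}
   Context: For $k\in\mathbb{Z}$, $Lif_k(t)=\sum_{m=0}^{\infty}\frac{t^m}{m!(m+1)^k}$, and the poly-Cauchy polynomials $C_n^{(k)}(x)$ are defined by $\frac{Lif_k(\log(1+t))}{(1+t)^x}=\sum_{n=0}^\infty C_n^{(k)}(x)\frac{t^n}{n!}$. The Stirling numbers of the first kind $S_1(n,l)$ are defined by $x(x-1)\cdots(x-n+1)=\sum_{l=0}^n S_1(n,l)x^l$. *)

theory Defs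
  imports "HOL-Computational_Algebra.Computational_Algebra"
begin

definition Lif :: "int \<Rightarrow> 'a::field_char_0 fps" where
  "Lif k = Abs_fps (\<lambda>m. 1 / (fact m * (of_nat m + 1) powi k))"

text \<open>
  Here \<^term>\<open>fps_ln 1\<close> is the series of $\log(1+t)$ and \<^term>\<open>fps_binomial x\<close> that of $(1+t)^x$.
\<close>

definition poly_cauchy :: "int \<Rightarrow> nat \<Rightarrow> 'a::field_char_0 \<Rightarrow> 'a" where
  "poly_cauchy k n x = fact n * fps_nth ((Lif k oo fps_ln 1) / fps_binomial x) n"

text \<open>
  Signed Stirling numbers of the first kind, as the coefficients of the falling factorial
  $x(x-1)\cdots(x-n+1)$; the library function \<open>stirling\<close> is the unsigned variant.
\<close>

definition S1 :: "nat \<Rightarrow> nat \<Rightarrow> int" where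
  "S1 n l = coeff (\<Prod>i<n. [:- int i, 1:]) l"

end

theory Submission imports Defs begin

text \<open>
  Let $F_x(t) = \mathrm{Lif}_k(\log(1+t))\,(1+t)^{-x}$ be the exponential generating function of
  $C_n^{(k)}(x)$. Differentiating gives
  $F_x' = \mathrm{Lif}_k'(\log(1+t))\,(1+t)^{-(x+1)} - x F_{x+1}$, and the first summand is
  $G(\log(1+t))$ for $G(u) = \mathrm{Lif}_k'(u)\,e^{-(x+1)u}$. Since
  $\log(1+t)^l / l! = \sum_n S_1(n,l)\, t^n / n!$, its coefficients are
  $\sum_l S_1(n,l)\, l!\,[u^l] G$, and $l!\,[u^l] G$ is a binomial convolution.
\<close>

lemma S1_0: "S1 0 l = (if l = 0 then 1 else 0)"
  by (simp add: S1_def)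

lemma S1_Suc_0: "S1 (Suc n) 0 = - int n * S1 n 0"
  by (simp add: S1_def coeff_mult mult.commute)

lemma S1_Suc_Suc: "S1 (Suc n) (Suc l) = S1 n l - int n * S1 n (Suc l)"
  by (simp add: S1_def mult.commute[of _ "[:_, _:]"])

text \<open>The factor \<open>1 + fps_X\<close> cancels the derivative 1/(1+t) of log(1+t), so
  comparing coefficients will give a recurrence with finitely many terms.\<close>

lemma one_plus_X_mult_deriv_ln_power:
  "(1 + fps_X) * fps_deriv (fps_ln 1 ^ Suc l) =
     fps_const (of_nat (Suc l)) * (fps_ln 1 ^ l :: 'a::field_char_0 fps)"
proof -
  have "(1 + fps_X) * inverse (1 + fps_X :: 'a fps) = 1"
    by (simp add: inverse_mult_eq_1')
  then show ?thesis
    by (simp add: fps_deriv_power fps_ln_deriv ac_simps del: power_Suc of_nat_Suc)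
qed

lemma ln_power_nth_Suc:
  fixes l n :: nat
  defines "L \<equiv> fps_ln 1 :: 'a::field_char_0 fps"
  shows "of_nat (Suc n) * (L ^ Suc l) $ Suc n =
    of_nat (Suc l) * (L ^ l) $ n - of_nat n * (L ^ Suc l) $ n"
proof -
  have "((1 + fps_X) * fps_deriv (L ^ Suc l)) $ n = (fps_const (of_nat (Suc l)) * L ^ l) $ n"
    unfolding L_def one_plus_X_mult_deriv_ln_power ..
  moreover have "((1 + fps_X) * fps_deriv (L ^ Suc l)) $ n =
      of_nat (Suc n) * (L ^ Suc l) $ Suc n + of_nat n * (L ^ Suc l) $ n"
    \<comment> \<open>Multiplication by \<open>fps_X\<close> shifts the index down. At n = 0 there
      is nothing to shift, and the factor \<open>of_nat n\<close> vanishes as well.\<close>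
    by (cases n) (simp_all add: ring_distribs del: power_Suc of_nat_Suc)
  ultimately show ?thesis
    by (simp add: algebra_simps del: power_Suc of_nat_Suc)
qed

text \<open>After scaling by n!/(l+1)!, \<open>ln_power_nth_Suc\<close> is the recurrence
  \<open>S1_Suc_Suc\<close>. It involves two adjacent columns, hence the induction is for all l at
  once.\<close>

lemma fact_mult_ln_power_nth:
  "fact n * (fps_ln 1 ^ l) $ n = (fact l * of_int (S1 n l) :: 'a::field_char_0)"
proof (induction n arbitrary: l)
  case 0
  show ?case by (cases l) (simp_all add: S1_0)
next
  case (Suc n)
  show ?case
  proof (cases l)
    case 0
    \<comment> \<open>Both sides are 0: \<open>S1_Suc_0\<close> has the factor n, which settles n =
      0, and for n > 0 the induction hypothesis gives \<open>S1 n 0 = 0\<close>.\<close>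
    then show ?thesis using Suc.IH[of 0] by (cases n) (auto simp: S1_Suc_0)
  next
    case (Suc m)
    have "fact (Suc n) * (fps_ln (1::'a) ^ Suc m) $ Suc n =
        fact n * (of_nat (Suc n) * (fps_ln 1 ^ Suc m) $ Suc n)"
      by (simp add: ac_simps del: power_Suc of_nat_Suc)
    also have "\<dots> = of_nat (Suc m) * (fact n * (fps_ln 1 ^ m) $ n)
        - of_nat n * (fact n * (fps_ln 1 ^ Suc m) $ n)"
      unfolding ln_power_nth_Suc by (simp add: algebra_simps del: power_Suc of_nat_Suc)
    also have "\<dots> = fact (Suc m) * of_int (S1 (Suc n) (Suc m))"
      unfolding Suc.IH S1_Suc_Suc by (simp add: algebra_simps)
    finally show ?thesis by (simp only: Suc)
  qed
qed

lemma fact_mult_compose_ln_nth: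
  fixes G :: "'a::field_char_0 fps"
  shows "fact n * (G oo fps_ln 1) $ n = (\<Sum>l=0..n. of_int (S1 n l) * (fact l * G $ l))"
  unfolding fps_compose_nth sum_distrib_left
proof (rule sum.cong[OF refl])
  fix l
  have "fact n * (G $ l * fps_ln 1 ^ l $ n) = G $ l * (fact n * fps_ln 1 ^ l $ n)"
    by (simp add: ac_simps)
  then show "fact n * (G $ l * fps_ln 1 ^ l $ n) = of_int (S1 n l) * (fact l * G $ l)"
    unfolding fact_mult_ln_power_nth by (simp add: ac_simps)
qed

text \<open>Both series solve y' = c y / (1+t) with constant term 1, and that solution is
  unique.\<close>

lemma fps_exp_compose_ln: "fps_exp c oo fps_ln 1 = fps_binomial (c::'a::field_char_0)"
proof -
  have "fps_deriv (fps_exp c oo fps_ln 1) = fps_const c * (fps_exp c oo fps_ln 1) / (1 + fps_X)"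
    by (simp add: fps_compose_deriv fps_ln_deriv fps_divide_unit fps_const_mult_apply_left)
  then show ?thesis
    using fps_binomial_ODE_unique' by fastforce
qed

lemma fps_divide_binomial:
  "f / fps_binomial x = f * fps_binomial (- x :: 'a::field_char_0)"
proof -
  have "fps_binomial x * fps_binomial (- x) = 1"
    by (simp flip: fps_binomial_add_mult)
  then have "inverse (fps_binomial x) = fps_binomial (- x)"
    by (rule fps_inverse_unique)
  then show ?thesis by (simp add: fps_divide_unit)
qed

text \<open>Product and chain rule: each of the two terms acquires a factor 1/(1+t), which turns the
  exponent -x into -(x+1).\<close>

lemma deriv_compose_ln_divide_binomial:
  fixes f :: "'a::field_char_0 fps"
  shows "fps_deriv ((f oo fps_ln 1) / fps_binomial x) =
    (fps_deriv f * fps_exp (- (x + 1)) oo fps_ln 1)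
    - fps_const x * ((f oo fps_ln 1) / fps_binomial (x + 1))"
proof -
  have shift: "fps_binomial (- (x + 1)) = fps_binomial (- x) * inverse (1 + fps_X)"
    using fps_binomial_add_mult[of "- x" "- 1"] by (simp add: fps_binomial_minus_one)
  show ?thesis
    unfolding fps_divide_binomial fps_compose_mult_distrib[OF fps_ln_0] fps_exp_compose_ln shift
    by (simp add: fps_compose_deriv fps_ln_deriv fps_binomial_deriv fps_divide_unit
        algebra_simps flip: fps_const_neg)
qed

text \<open>The factor m+1 from differentiation reduces (m+1)! to m!, while the base m+1 has moved
  on to m+2.\<close>

lemma fact_mult_deriv_Lif_nth:
  "fact m * fps_deriv (Lif k) $ m = 1 / (of_nat (m + 2) powi k :: 'a::field_char_0)"
proof -
  have "fps_deriv (Lif k) $ m =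
      of_nat (Suc m) / (of_nat (Suc m) * fact m * (of_nat (m + 2) powi k :: 'a))"
    by (simp add: Lif_def add_ac)
  then show ?thesis by (simp del: of_nat_Suc)
qed

lemma fact_mult_fps_mult_exp_nth:
  fixes f :: "'a::field_char_0 fps"
  shows "fact l * (f * fps_exp c) $ l =
    (\<Sum>j=0..l. of_nat (l choose j) * c ^ j * (fact (l - j) * f $ (l - j)))"
proof -
  \<comment> \<open>The exponential comes first so that the convolution index j is the exponent of
    c.\<close>
  have "fact l * (fps_exp c * f) $ l = (\<Sum>j=0..l. fact l * (c ^ j / fact j * f $ (l - j)))"
    by (simp add: fps_mult_nth sum_distrib_left)
  also have "\<dots> = (\<Sum>j=0..l. of_nat (l choose j) * c ^ j * (fact (l - j) * f $ (l - j)))"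
    by (rule sum.cong) (simp_all add: binomial_fact)
  finally show ?thesis by (simp only: mult.commute)
qed

theorem theorem3:
  fixes k :: int and n :: nat and x :: "'a::field_char_0"
  shows "poly_cauchy k (n + 1) x =
    (\<Sum>l=0..n. of_int (S1 n l) *
      (\<Sum>j=0..l. (- 1) ^ j * of_nat (l choose j) / (of_nat (l - j + 2)) powi k * (x + 1) ^ j))
    - x * poly_cauchy k n (x + 1)"
proof -
  define G where "G = fps_deriv (Lif k) * fps_exp (- (x + 1))"
  have G: "fact l * G $ l =
      (\<Sum>j=0..l. (- 1) ^ j * of_nat (l choose j) / (of_nat (l - j + 2)) powi k * (x + 1) ^ j)" for l
    unfolding G_def fact_mult_fps_mult_exp_nth fact_mult_deriv_Lif_nth
      power_minus[of "x + 1"]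
    by (simp add: ac_simps)
  \<comment> \<open>Differentiating an exponential generating function shifts its sequence by
    one.\<close>
  have "poly_cauchy k (n + 1) x = fact n * fps_deriv ((Lif k oo fps_ln 1) / fps_binomial x) $ n"
    by (simp add: poly_cauchy_def)
  also have "\<dots> = fact n * (G oo fps_ln 1) $ n - x * poly_cauchy k n (x + 1)"
    unfolding deriv_compose_ln_divide_binomial G_def by (simp add: poly_cauchy_def algebra_simps)
  finally show ?thesis
    unfolding fact_mult_compose_ln_nth G .
qed

end
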